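(* Let $G$ be a non-abelian finite group, and let \[ \{m\ge 2:c_m(G)\neq 0\}=\{m_1<\cdots<m_t\}. \] Write $\lambda_j:=m_j^{-1}$ for $1\le j\le t$, and let $\sigma_j$ be the $j$th elementary symmetric polynomial in $\lambda_1,\dots,\lambda_t$. Then, for every $r\ge 2$, \[ P_{r+t}(G)=\sigma_1P_{r+t-1}(G)-\sigma_2P_{r+t-2}(G)+\cdots+(-1)^{t-1}\sigma_tP_r(G). \] This recurrence has minimal order $t$ (the sequence $(P_r(G))_{r\ge 2}$ satisfies no constant-coefficient linear recurrence of order smaller than $t$). Equivalently, the infinite Hankel matrix \[ \mathsf H_G:=\bigl(P_{i+j+2}(G)\bigr)_{i,j\ge 0} \] has rank $t$. In particular, once the spectral size $t$ is fixed, the initial block $P_2(G),P_3(G),\dots,P_{2t+1}(G)$ determines the entire hierarchy $\{P_r(G)\}_{r\ge 2}$; that is, if $H$ is a non-abelian finite group with the same number $t$ of nonzero coefficients $c_m(H)$ and $P_r(H)=P_r(G)$ for $2\le r\le 2t+1$, then $P_r(H)=P_r(G)$ for all $r\ge 2$.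
   Context: For a finite group $G$ and $r\ge1$, $P_r(G):=|\mathrm{Hom}(\mathbb Z^r,G)|/|G|^r$, where $\mathrm{Hom}(\mathbb Z^r,G)$ is the set of pairwise commuting $r$-tuples in $G^r$. For non-abelian $G$ and $m\ge2$, $c_m(G):=-\sum_{A}\mu_2(A,G)$, the sum over all abelian subgroups $A\le G$ with $|G:A|=m$, where $\mu_2$ is the Möbius function of the poset (under inclusion) consisting of all abelian subgroups of $G$ together with $G$ itself. Only finitely many $c_m(G)$ are nonzero, and $P_r(G)=\sum_{m\ge2}c_m(G)m^{-r}$ for all $r\ge2$. The spectral size of $G$ is the number of $m\ge 2$ with $c_m(G)\ne 0$. *)

theory Defs
  imports Complex_Main "HOL-Library.FuncSet" "HOL-Library.Function_Algebras" "HOL-Algebra.Coset"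
begin

definition commuting_tuples :: "('a, 'b) monoid_scheme \<Rightarrow> nat \<Rightarrow> (nat \<Rightarrow> 'a) set" where
  "commuting_tuples G r =
     {x \<in> {..<r} \<rightarrow>\<^sub>E carrier G. \<forall>i<r. \<forall>j<r. x i \<otimes>\<^bsub>G\<^esub> x j = x j \<otimes>\<^bsub>G\<^esub> x i}"

definition commuting_prob :: "('a, 'b) monoid_scheme \<Rightarrow> nat \<Rightarrow> real" where
  "commuting_prob G r = real (card (commuting_tuples G r)) / real (order G) ^ r"

text \<open>
  Moebius function of a finite poset \<open>S\<close>: \<open>\<mu>(x, x) = 1\<close>, \<open>\<mu>(x, y) = 0\<close> unless \<open>x \<le> y\<close>, and
  \<open>\<Sum>\<^bsub>x \<le> z \<le> y\<^esub> \<mu>(z, y) = 0\<close> for \<open>x < y\<close> (P. Hall's form of the recursion).  The guard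
  \<open>finite S\<close> only serves termination.
\<close>
function moebius :: "'p::order set \<Rightarrow> 'p \<Rightarrow> 'p \<Rightarrow> int" where
  "moebius S x y =
     (if x = y then 1
      else if finite S \<and> x < y then - (\<Sum>z\<in>{z \<in> S. x < z \<and> z \<le> y}. moebius S z y)
      else 0)"
  by auto
termination
proof (relation "measure (\<lambda>(S, x, y). card {z \<in> S. x < z})", simp, clarsimp)
  fix S :: "'p::order set" and x z :: 'p
  assume "finite S" "z \<in> S" "x < z"
  then show "card {w \<in> S. z < w} < card {w \<in> S. x < w}"
    by (intro psubset_card_mono) auto
qed

declare moebius.simps [simp del]

definition abelian_subgroups :: "('a, 'b) monoid_scheme \<Rightarrow> 'a set set" where
  "abelian_subgroups G = {A. subgroup A G \<and> comm_group (G\<lparr>carrier := A\<rparr>)}"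

definition mu2 :: "('a, 'b) monoid_scheme \<Rightarrow> 'a set \<Rightarrow> 'a set \<Rightarrow> int" where
  "mu2 G = moebius (insert (carrier G) (abelian_subgroups G))"

definition coeff_c :: "('a, 'b) monoid_scheme \<Rightarrow> nat \<Rightarrow> int" where
  "coeff_c G m = - (\<Sum>A\<in>{A \<in> abelian_subgroups G. card (rcosets\<^bsub>G\<^esub> A) = m}. mu2 G A (carrier G))"

definition spectrum :: "('a, 'b) monoid_scheme \<Rightarrow> nat set" where
  "spectrum G = {m. m \<ge> 2 \<and> coeff_c G m \<noteq> 0}"

definition spectral_size :: "('a, 'b) monoid_scheme \<Rightarrow> nat" where
  "spectral_size G = card (spectrum G)"

lemma finite_spectrum:
  assumes "finite (carrier G)"
  shows "finite (spectrum G)"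
proof -
  have "abelian_subgroups G \<subseteq> Pow (carrier G)"
    by (auto simp: abelian_subgroups_def dest: subgroup.subset)
  then have fin: "finite (abelian_subgroups G)"
    using assms by (meson finite_Pow_iff finite_subset)
  have "spectrum G \<subseteq> (\<lambda>A. card (rcosets\<^bsub>G\<^esub> A)) ` abelian_subgroups G"
  proof
    fix m assume "m \<in> spectrum G"
    then have "(\<Sum>A\<in>{A \<in> abelian_subgroups G. card (rcosets\<^bsub>G\<^esub> A) = m}. mu2 G A (carrier G)) \<noteq> 0"
      by (simp add: spectrum_def coeff_c_def)
    then obtain A where "A \<in> {A \<in> abelian_subgroups G. card (rcosets\<^bsub>G\<^esub> A) = m}"
      by (rule sum.not_neutral_contains_not_neutral)
    then show "m \<in> (\<lambda>A. card (rcosets\<^bsub>G\<^esub> A)) ` abelian_subgroups G"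
      by blast
  qed
  with fin show ?thesis
    by (meson finite_imageI finite_subset)
qed

definition elem_sym :: "'i set \<Rightarrow> ('i \<Rightarrow> 'a::comm_semiring_1) \<Rightarrow> nat \<Rightarrow> 'a" where
  "elem_sym I v j = (\<Sum>J\<in>{J. J \<subseteq> I \<and> card J = j}. \<Prod>i\<in>J. v i)"

definition satisfies_linear_recurrence :: "(nat \<Rightarrow> real) \<Rightarrow> nat \<Rightarrow> bool" where
  "satisfies_linear_recurrence u d \<longleftrightarrow> (\<exists>a. \<forall>n. u (n + d) = (\<Sum>j=1..d. a j * u (n + d - j)))"

interpretation seq: vector_space "\<lambda>(c::real) (f :: nat \<Rightarrow> real) n. c * f n"
  by standard (auto simp: fun_eq_iff algebra_simps)

text \<open>
  The column space has a basis with \<open>k\<close> elements.  In contrast to an equation \<open>seq.dim _ = k\<close>, this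
  excludes infinite rank also for \<open>k = 0\<close>.
\<close>
definition has_rank :: "(nat \<Rightarrow> nat \<Rightarrow> real) \<Rightarrow> nat \<Rightarrow> bool" where
  "has_rank M k \<longleftrightarrow>
     (\<exists>B. finite B \<and> card B = k \<and> seq.independent B \<and>
          seq.span B = seq.span (range (\<lambda>j i. M i j)))"

definition hankel :: "('a, 'b) monoid_scheme \<Rightarrow> nat \<Rightarrow> nat \<Rightarrow> real" where
  "hankel G i j = commuting_prob G (i + j + 2)"

end

theory Submission
  imports Defs "HOL-Computational_Algebra.Polynomial" "HOL-Algebra.Generated_Groups"
begin

text \<open>
  Moebius inversion: a commuting tuple generates an abelian subgroup \<open>K < G\<close>, and
  \<open>\<Sum>\<^bsub>K \<le> A < G\<^esub> \<mu>\<^sub>2(A, G) = -1\<close>. Summing over all commuting tuples and counting the tuples in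
  each abelian \<open>A\<close> gives \<open>P\<^sub>r(G) = \<Sum>\<^bsub>m\<^esub> c\<^sub>m(G) m\<^bsup>-r\<^esup>\<close>, an exponential sum with \<open>t\<close> distinct
  nonzero bases and nonzero coefficients. The rest holds for all such sums: evaluating them on the
  coefficients of the Lagrange polynomial \<open>\<Prod>\<^bsub>j \<noteq> i\<^esub> (X - \<lambda>\<^sub>j)\<close> isolates the \<open>i\<close>th term.
\<close>

section \<open>Exponential sums\<close>

text \<open>Interchanging the sums shows that combining consecutive terms with the coefficients of
  \<open>p\<close> multiplies each weight \<open>b i\<close> by \<open>poly p (v i)\<close>. The
  choice of \<open>p\<close> therefore decides which terms survive.\<close>

lemma sum_coeff_exp_sum:
  fixes b v :: "'i \<Rightarrow> 'a::comm_ring_1"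
  shows "(\<Sum>n\<le>degree p. coeff p n * (\<Sum>i\<in>I. b i * v i ^ n)) = (\<Sum>i\<in>I. b i * poly p (v i))"
proof -
  have "(\<Sum>n\<le>degree p. coeff p n * (\<Sum>i\<in>I. b i * v i ^ n))
      = (\<Sum>n\<le>degree p. \<Sum>i\<in>I. b i * (coeff p n * v i ^ n))"
    by (simp add: sum_distrib_left mult_ac)
  also have "\<dots> = (\<Sum>i\<in>I. \<Sum>n\<le>degree p. b i * (coeff p n * v i ^ n))"
    by (rule sum.swap)
  also have "\<dots> = (\<Sum>i\<in>I. b i * poly p (v i))"
    by (simp add: poly_altdef sum_distrib_left)
  finally show ?thesis .
qed

text \<open>The Lagrange basis polynomial without its normalising denominator. It thus makes sense
  over any commutative ring; over a domain with distinct nodes its value at \<open>v i\<close> is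
  nonzero and can be cancelled.\<close>

definition lagrange_numerator :: "'i set \<Rightarrow> ('i \<Rightarrow> 'a::comm_ring_1) \<Rightarrow> 'i \<Rightarrow> 'a poly" where
  "lagrange_numerator I v i = (\<Prod>j\<in>I - {i}. [:- v j, 1:])"

lemma degree_lagrange_numerator_less:
  assumes "finite I" "i \<in> I"
  shows "degree (lagrange_numerator I v i) < card I"
proof -
  have "degree (lagrange_numerator I v i) \<le> (\<Sum>j\<in>I - {i}. (degree \<circ> (\<lambda>j. [:- v j, 1:])) j)"
    unfolding lagrange_numerator_def using assms by (intro degree_prod_sum_le) auto
  also have "\<dots> \<le> (\<Sum>j\<in>I - {i}. 1)"
    by (intro sum_mono) simp
  also have "\<dots> < card I"
    using assms card_gt_0_iff[of I] by auto
  finally show ?thesis .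
qed

lemma poly_lagrange_numerator_eq_0:
  assumes "finite I" "j \<in> I" "j \<noteq> i"
  shows "poly (lagrange_numerator I v i) (v j) = 0"
  using assms unfolding lagrange_numerator_def poly_prod by (intro prod_zero) auto

lemma poly_lagrange_numerator_nonzero:
  fixes v :: "'i \<Rightarrow> 'a::idom"
  assumes "finite I" "inj_on v I" "i \<in> I"
  shows "poly (lagrange_numerator I v i) (v i) \<noteq> 0"
  using assms by (auto simp: lagrange_numerator_def poly_prod inj_on_def)

lemma sum_lagrange_numerator:
  assumes "finite I" "i \<in> I"
  shows "(\<Sum>j\<in>I. b j * poly (lagrange_numerator I v i) (v j))
       = b i * poly (lagrange_numerator I v i) (v i)"
proof -
  have "(\<Sum>j\<in>I. b j * poly (lagrange_numerator I v i) (v j))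
      = (\<Sum>j\<in>{i}. b j * poly (lagrange_numerator I v i) (v j))"
    using assms by (intro sum.mono_neutral_right) (auto simp: poly_lagrange_numerator_eq_0)
  then show ?thesis by simp
qed

text \<open>Nonsingularity of the Vandermonde matrix without determinants. The Lagrange numerator
  has degree below \<open>card I\<close>, so its combination involves only vanishing sums, yet it
  equals \<open>b i\<close> times a nonzero value.\<close>

lemma exp_sum_coeffs_eq_0:
  fixes b v :: "'i \<Rightarrow> 'a::idom"
  assumes "finite I" "inj_on v I" "card I \<le> N"
    and vanish: "\<And>n. n < N \<Longrightarrow> (\<Sum>i\<in>I. b i * v i ^ n) = 0"
    and "i \<in> I"
  shows "b i = 0"
proof -
  let ?p = "lagrange_numerator I v i"
  have "degree ?p < N"
    using degree_lagrange_numerator_less[of I i v] assms by simp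
  then have "(\<Sum>n\<le>degree ?p. coeff ?p n * (\<Sum>i\<in>I. b i * v i ^ n)) = 0"
    by (intro sum.neutral) (simp add: vanish)
  then have "b i * poly ?p (v i) = 0"
    using assms by (simp add: sum_coeff_exp_sum sum_lagrange_numerator)
  with poly_lagrange_numerator_nonzero[of I v i] assms show ?thesis
    by simp
qed

section \<open>Recurrences and their characteristic polynomials\<close>

lemma prod_diff_eq_elem_sym:
  fixes v :: "'i \<Rightarrow> 'a::comm_ring_1"
  assumes "finite I"
  shows "(\<Prod>i\<in>I. x - v i) = (\<Sum>j\<le>card I. (-1) ^ j * elem_sym I v j * x ^ (card I - j))"
proof -
  have "(\<Prod>i\<in>I. x - v i)
      = (\<Sum>X\<in>Pow I. (-1) ^ card X * (\<Prod>i\<in>X. v i) * (\<Prod>i\<in>I - X. x))"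
    using assms by (rule prod_diff_conv_sum)
  also have "\<dots> = (\<Sum>X\<in>Pow I. (-1) ^ card X * (\<Prod>i\<in>X. v i) * x ^ (card I - card X))"
    using assms by (intro sum.cong refl) (auto simp: card_Diff_subset finite_subset)
  \<comment> \<open>Subsets are grouped by size; each group yields one elementary symmetric
    polynomial.\<close>
  also have "\<dots> = (\<Sum>j\<le>card I. \<Sum>X\<in>{X\<in>Pow I. card X = j}.
      (-1) ^ card X * (\<Prod>i\<in>X. v i) * x ^ (card I - card X))"
    using assms by (intro sum.group[symmetric]) (auto intro: card_mono)
  also have "\<dots> = (\<Sum>j\<le>card I. (-1) ^ j * elem_sym I v j * x ^ (card I - j))"
    by (intro sum.cong refl) (simp add: elem_sym_def sum_distrib_left sum_distrib_right)
  finally show ?thesis .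
qed

text \<open>\<open>v i\<close> is a root of the product of all X - \<open>v k\<close>; Vieta's
  expansion is solved for the leading power, which shifts the signs from \<open>(-1) ^ j\<close> to
  \<open>(-1) ^ (j - 1)\<close>.\<close>

lemma power_card_eq_elem_sym:
  fixes v :: "'i \<Rightarrow> 'a::comm_ring_1"
  assumes "finite I" "i \<in> I"
  shows "v i ^ card I
       = (\<Sum>j=1..card I. (-1) ^ (j - 1) * elem_sym I v j * v i ^ (card I - j))"
proof -
  have empty: "{J. J \<subseteq> I \<and> card J = 0} = {{}}"
    using assms(1) by (auto dest: finite_subset)
  have neg: "(-1) ^ j = - ((-1) ^ (j - 1) :: 'a)" if "j \<ge> 1" for j :: nat
    using that by (cases j) auto
  have "0 = (\<Prod>k\<in>I. v i - v k)"
    using assms by (intro prod_zero[symmetric]) auto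
  also have "\<dots> = (\<Sum>j\<le>card I. (-1) ^ j * elem_sym I v j * v i ^ (card I - j))"
    by (rule prod_diff_eq_elem_sym) fact
  also have "\<dots> = v i ^ card I + (\<Sum>j=1..card I. (-1) ^ j * elem_sym I v j * v i ^ (card I - j))"
    \<comment> \<open>The term j = 0 is the leading power: only the empty set contributes to
      \<open>elem_sym I v 0\<close>, and its product is 1.\<close>
    by (simp add: atMost_atLeast0 sum.atLeast_Suc_atMost elem_sym_def empty)
  also have "(\<Sum>j=1..card I. (-1) ^ j * elem_sym I v j * v i ^ (card I - j))
      = - (\<Sum>j=1..card I. (-1) ^ (j - 1) * elem_sym I v j * v i ^ (card I - j))"
    unfolding sum_negf[symmetric] by (intro sum.cong refl) (simp add: neg)
  finally show ?thesis
    by simp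
qed

text \<open>Serves both directions: with the elementary symmetric coefficients it proves the
  recurrence, with arbitrary \<open>a\<close> it turns an assumed recurrence into a condition on the
  \<open>v i\<close>.\<close>

lemma exp_sum_shift:
  fixes b v :: "'i \<Rightarrow> 'a::comm_ring_1"
  shows "(\<Sum>j=1..d. a j * (\<Sum>i\<in>I. b i * v i ^ (n + d - j)))
       = (\<Sum>i\<in>I. b i * (\<Sum>j=1..d. a j * v i ^ (d - j)) * v i ^ n)"
proof -
  have "(\<Sum>j=1..d. a j * (\<Sum>i\<in>I. b i * v i ^ (n + d - j)))
      = (\<Sum>j=1..d. \<Sum>i\<in>I. b i * (a j * v i ^ (d - j)) * v i ^ n)"
    unfolding sum_distrib_left
  proof (intro sum.cong refl)
    fix j i
    assume "j \<in> {1..d}"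
    then have "n + d - j = (d - j) + n"
      by simp
    then show "a j * (b i * v i ^ (n + d - j)) = b i * (a j * v i ^ (d - j)) * v i ^ n"
      by (simp add: power_add mult_ac)
  qed
  also have "\<dots> = (\<Sum>i\<in>I. \<Sum>j=1..d. b i * (a j * v i ^ (d - j)) * v i ^ n)"
    by (rule sum.swap)
  finally show ?thesis
    by (simp add: sum_distrib_left sum_distrib_right)
qed

lemma exp_sum_recurrence:
  fixes b v :: "'i \<Rightarrow> 'a::comm_ring_1"
  assumes "finite I"
  shows "(\<Sum>i\<in>I. b i * v i ^ (n + card I))
       = (\<Sum>j=1..card I. (-1) ^ (j - 1) * elem_sym I v j * (\<Sum>i\<in>I. b i * v i ^ (n + card I - j)))"
  unfolding exp_sum_shift
proof (intro sum.cong refl)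
  fix i
  assume "i \<in> I"
  show "b i * v i ^ (n + card I)
      = b i * (\<Sum>j=1..card I. (-1) ^ (j - 1) * elem_sym I v j * v i ^ (card I - j)) * v i ^ n"
    unfolding power_card_eq_elem_sym[OF assms \<open>i \<in> I\<close>, symmetric]
    by (simp add: power_add mult_ac)
qed

text \<open>All terms have nonzero weight, so each \<open>v i\<close> must be a root of the
  characteristic polynomial of any recurrence satisfied. A nonzero polynomial of degree at most
  \<open>d\<close> cannot have \<open>card I\<close> distinct roots.\<close>

lemma exp_sum_no_shorter_recurrence:
  fixes b v :: "'i \<Rightarrow> real"
  assumes "finite I" "inj_on v I" "\<And>i. i \<in> I \<Longrightarrow> b i \<noteq> 0" "d < card I"
  shows "\<not> satisfies_linear_recurrence (\<lambda>n. \<Sum>i\<in>I. b i * v i ^ n) d"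
proof
  assume "satisfies_linear_recurrence (\<lambda>n. \<Sum>i\<in>I. b i * v i ^ n) d"
  then obtain a where a: "(\<Sum>i\<in>I. b i * v i ^ (n + d))
      = (\<Sum>j=1..d. a j * (\<Sum>i\<in>I. b i * v i ^ (n + d - j)))" for n
    unfolding satisfies_linear_recurrence_def by blast
  define q where "q = monom 1 d - (\<Sum>j=1..d. monom (a j) (d - j))"
  have poly_q: "poly q x = x ^ d - (\<Sum>j=1..d. a j * x ^ (d - j))" for x
    by (simp add: q_def poly_sum poly_monom)
  \<comment> \<open>The recurrence at \<open>n\<close> says that the exponential sum with modified
    weights \<open>b i * poly q (v i)\<close> vanishes.\<close>
  have "(\<Sum>i\<in>I. (b i * poly q (v i)) * v i ^ n) = 0" for n
    using a[of n] unfolding exp_sum_shift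
    by (simp add: poly_q algebra_simps power_add sum_subtractf)
  then have "b i * poly q (v i) = 0" if "i \<in> I" for i
    by (rule exp_sum_coeffs_eq_0[where b = "\<lambda>i. b i * poly q (v i)", OF assms(1,2) order.refl _ that])
  then have roots: "v ` I \<subseteq> {x. poly q x = 0}"
    using assms(3) by auto
  \<comment> \<open>Every subtracted monomial has exponent \<open>d - j\<close> with j between 1 and
    \<open>d\<close>, hence below \<open>d\<close>.\<close>
  have "coeff q d = 1"
    by (auto simp: q_def coeff_sum intro!: sum.neutral)
  then have "q \<noteq> 0"
    by auto
  have "card (v ` I) \<le> card {x. poly q x = 0}"
    using poly_roots_finite[OF \<open>q \<noteq> 0\<close>] roots by (rule card_mono)
  also have "\<dots> \<le> degree q"
    using \<open>q \<noteq> 0\<close> by (rule card_poly_roots_bound)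
  also have "degree q \<le> d"
    unfolding q_def
    by (intro degree_diff_le degree_sum_le) (auto intro: order_trans[OF degree_monom_le])
  finally show False
    using assms by (simp add: card_image)
qed

section \<open>Rank of the Hankel matrix\<close>

lemma sum_fun_apply: "(\<Sum>i\<in>I. f i) x = (\<Sum>i\<in>I. f i x)"
  by (induction I rule: infinite_finite_induct) auto

text \<open>The geometric sequences \<open>g i\<close> form a basis of the column space. They are
  independent by the Vandermonde argument and span all columns; conversely, the Lagrange numerators
  recover each of them from finitely many columns.\<close>

lemma has_rank_hankel_exp_sum:
  fixes b v :: "'i \<Rightarrow> real"
  assumes fin: "finite I" and inj: "inj_on v I" and nz: "\<And>i. i \<in> I \<Longrightarrow> b i \<noteq> 0"
  shows "has_rank (\<lambda>k l. \<Sum>i\<in>I. b i * v i ^ (k + l)) (card I)"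
proof -
  define g where "g i = (\<lambda>n. v i ^ n)" for i
  define col where "col l = (\<lambda>k. \<Sum>i\<in>I. b i * v i ^ (k + l))" for l
  have inj_g: "inj_on g I"
  proof (rule inj_onI)
    fix i j
    assume ij: "i \<in> I" "j \<in> I" "g i = g j"
    have "v i = v j"
      using fun_cong[OF ij(3), of 1] by (simp add: g_def)
    then show "i = j"
      using inj ij by (simp add: inj_on_eq_iff)
  qed
  have "seq.independent (g ` I)"
  proof (rule seq.independent_if_scalars_zero)
    fix f x
    assume eq: "(\<Sum>x\<in>g ` I. (\<lambda>n. f x * x n)) = 0" and "x \<in> g ` I"
    then obtain i where i: "i \<in> I" "x = g i"
      by blast
    have "(\<Sum>j\<in>I. f (g j) * v j ^ n) = 0" for n
      using fun_cong[OF eq, of n] by (simp add: sum.reindex[OF inj_g] sum_fun_apply) (simp add: g_def)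
    then show "f x = 0"
      unfolding i
      using exp_sum_coeffs_eq_0[where b = "\<lambda>j. f (g j)" and v = v] fin inj i(1) by blast
  qed (use fin in simp)
  moreover have "seq.span (g ` I) = seq.span (range col)"
    unfolding seq.span_eq
  proof (intro conjI subsetI)
    fix x
    assume "x \<in> g ` I"
    then obtain i where i: "i \<in> I" "x = g i"
      by blast
    let ?p = "lagrange_numerator I v i"
    have nonzero: "b i * poly ?p (v i) \<noteq> 0"
      using nz poly_lagrange_numerator_nonzero fin inj i by simp
    \<comment> \<open>For fixed row \<open>n\<close>, the entries \<open>col l n\<close> form an
      exponential sum in \<open>l\<close> with weights \<open>b j * v j ^ n\<close>, from which
      \<open>?p\<close> isolates the \<open>i\<close>th term.\<close>
    have "(\<Sum>l\<le>degree ?p. coeff ?p l * col l n) = b i * poly ?p (v i) * v i ^ n" for n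
      using sum_coeff_exp_sum[of ?p "\<lambda>j. b j * v j ^ n" v I]
        sum_lagrange_numerator[OF fin i(1), of "\<lambda>j. b j * v j ^ n" v]
      by (simp add: col_def power_add mult_ac)
    then have "x = (\<lambda>n. inverse (b i * poly ?p (v i)) *
        (\<Sum>l\<le>degree ?p. (\<lambda>n. coeff ?p l * col l n)) n)"
      using nonzero by (auto simp: sum_fun_apply i g_def fun_eq_iff field_simps)
    moreover have "(\<lambda>n. inverse (b i * poly ?p (v i)) *
        (\<Sum>l\<le>degree ?p. (\<lambda>n. coeff ?p l * col l n)) n) \<in> seq.span (range col)"
      by (intro seq.span_scale seq.span_sum seq.span_base) auto
    ultimately show "x \<in> seq.span (range col)"
      by simp
  next
    fix x
    assume "x \<in> range col"
    then obtain l where "x = col l"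
      by blast
    then have "x = (\<Sum>i\<in>I. (\<lambda>n. (b i * v i ^ l) * g i n))"
      by (simp add: fun_eq_iff sum_fun_apply col_def g_def power_add mult_ac)
    also have "\<dots> \<in> seq.span (g ` I)"
      by (intro seq.span_sum seq.span_scale seq.span_base) auto
    finally show "x \<in> seq.span (g ` I)" .
  qed
  ultimately show ?thesis
    unfolding has_rank_def col_def
    using fin card_image[OF inj_g] by (intro exI[of _ "g ` I"]) auto
qed

section \<open>Commuting tuples and abelian subgroups\<close>

lemma (in group) abelian_subgroups_commute:
  assumes "A \<in> abelian_subgroups G" "x \<in> A" "y \<in> A"
  shows "x \<otimes> y = y \<otimes> x"
proof -
  interpret A: comm_group "G\<lparr>carrier := A\<rparr>"
    using assms by (simp add: abelian_subgroups_def)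
  show ?thesis
    using A.m_comm[of x y] assms by simp
qed

text \<open>The centralizer of \<open>y\<close> contains \<open>X\<close> and is closed under
  products and inverses; the induction checks this closure.\<close>

lemma (in group) generate_commutes:
  assumes "X \<subseteq> carrier G" "y \<in> carrier G" "\<And>x. x \<in> X \<Longrightarrow> x \<otimes> y = y \<otimes> x"
    and "z \<in> generate G X"
  shows "z \<otimes> y = y \<otimes> z"
  using assms(4)
proof (induction rule: generate.induct)
  case one
  then show ?case using assms by simp
next
  case (incl h)
  then show ?case using assms by simp
next
  case (inv h)
  have h: "h \<in> carrier G" "h \<otimes> y = y \<otimes> h"
    using inv assms by auto
  have "inv h \<otimes> y = inv h \<otimes> (y \<otimes> h) \<otimes> inv h"
    using h assms(2) by (simp add: m_assoc)
  also have "\<dots> = inv h \<otimes> (h \<otimes> y) \<otimes> inv h"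
    using h by simp
  also have "\<dots> = y \<otimes> inv h"
    using h(1) assms(2) by (simp flip: m_assoc)
  finally show ?case .
next
  case (eng h1 h2)
  have "h1 \<in> carrier G" "h2 \<in> carrier G"
    using eng generate_in_carrier assms(1) by auto
  then show ?case
    using eng assms(2) by (metis m_assoc)
qed

lemma (in group) generate_commuting_in_abelian_subgroups:
  assumes "X \<subseteq> carrier G" "\<And>x y. x \<in> X \<Longrightarrow> y \<in> X \<Longrightarrow> x \<otimes> y = y \<otimes> x"
  shows "generate G X \<in> abelian_subgroups G"
proof -
  have sub: "subgroup (generate G X) G"
    by (rule generate_is_subgroup) fact
  \<comment> \<open>Centralizers are used twice: first generated elements commute with
    \<open>X\<close>, then, with a generated element held fixed, with each other.\<close>
  have 1: "z \<otimes> y = y \<otimes> z" if "z \<in> generate G X" "y \<in> X" for y z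
    using generate_commutes[OF assms(1) _ _ that(1)] assms that by blast
  have "z \<otimes> y = y \<otimes> z" if "z \<in> generate G X" "y \<in> generate G X" for y z
  proof (rule generate_commutes[OF assms(1) _ _ that(1)])
    show "y \<in> carrier G"
      using generate_in_carrier[OF assms(1) that(2)] .
    show "x \<otimes> y = y \<otimes> x" if "x \<in> X" for x
      using 1[OF \<open>y \<in> generate G X\<close> that] by simp
  qed
  then have "comm_group (G\<lparr>carrier := generate G X\<rparr>)"
    by (intro group.group_comm_groupI[OF subgroup_imp_group[OF sub]]) simp
  with sub show ?thesis
    by (simp add: abelian_subgroups_def)
qed

lemma finite_abelian_subgroups:
  assumes "finite (carrier G)"
  shows "finite (abelian_subgroups G)"
proof -
  have "abelian_subgroups G \<subseteq> Pow (carrier G)"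
    by (auto simp: abelian_subgroups_def dest: subgroup.subset)
  with assms show ?thesis
    by (meson finite_Pow_iff finite_subset)
qed

lemma carrier_notin_abelian_subgroups:
  assumes "\<not> comm_group G"
  shows "carrier G \<notin> abelian_subgroups G"
proof
  assume "carrier G \<in> abelian_subgroups G"
  then interpret C: comm_group "G\<lparr>carrier := carrier G\<rparr>"
    by (simp add: abelian_subgroups_def)
  have "comm_group G"
    using C.comm_group_axioms by simp
  with assms show False ..
qed

section \<open>Moebius inversion and the spectral formula\<close>

lemma sum_moebius_eq_0:
  assumes "finite S" "x \<in> S" "x < y"
  shows "(\<Sum>z\<in>{z\<in>S. x \<le> z \<and> z \<le> y}. moebius S z y) = 0"
proof -
  have "{z\<in>S. x \<le> z \<and> z \<le> y} = insert x {z\<in>S. x < z \<and> z \<le> y}"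
    using assms by auto
  then have "(\<Sum>z\<in>{z\<in>S. x \<le> z \<and> z \<le> y}. moebius S z y)
      = moebius S x y + (\<Sum>z\<in>{z\<in>S. x < z \<and> z \<le> y}. moebius S z y)"
    using assms(1) by simp
  also have "moebius S x y = - (\<Sum>z\<in>{z\<in>S. x < z \<and> z \<le> y}. moebius S z y)"
    using assms by (subst moebius.simps) auto
  finally show ?thesis
    by simp
qed

text \<open>An abelian subgroup contains \<open>X\<close> exactly if it contains the abelian
  subgroup generated by \<open>X\<close>, which is proper as G is non-abelian. The Moebius values
  over the interval from there to G sum to 0, and G itself contributes 1.\<close>

lemma (in group) sum_mu2_abelian_overgroups:
  assumes fin: "finite (carrier G)" and nonab: "\<not> comm_group G"
    and X: "X \<subseteq> carrier G" "\<And>x y. x \<in> X \<Longrightarrow> y \<in> X \<Longrightarrow> x \<otimes> y = y \<otimes> x"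
  shows "(\<Sum>A\<in>{A\<in>abelian_subgroups G. X \<subseteq> A}. mu2 G A (carrier G)) = -1"
proof -
  let ?S = "insert (carrier G) (abelian_subgroups G)" and ?K = "generate G X"
  have K: "?K \<in> abelian_subgroups G"
    using X by (rule generate_commuting_in_abelian_subgroups)
  have notin: "carrier G \<notin> abelian_subgroups G"
    using nonab by (rule carrier_notin_abelian_subgroups)
  have finS: "finite (abelian_subgroups G)"
    using fin by (rule finite_abelian_subgroups)
  have "?K \<subset> carrier G"
    using generate_incl[OF X(1)] K notin by auto
  then have "0 = (\<Sum>A\<in>{A\<in>?S. ?K \<subseteq> A \<and> A \<subseteq> carrier G}. mu2 G A (carrier G))"
    unfolding mu2_def using K finS by (intro sum_moebius_eq_0[symmetric]) auto
  also have "{A\<in>?S. ?K \<subseteq> A \<and> A \<subseteq> carrier G}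
      = insert (carrier G) {A\<in>abelian_subgroups G. X \<subseteq> A}"
    using generate_incl[OF X(1)] generate_subgroup_incl[of X] generate.incl[of _ X G]
    by (auto simp: abelian_subgroups_def dest: subgroup.subset)
  also have "(\<Sum>A\<in>\<dots>. mu2 G A (carrier G))
      = 1 + (\<Sum>A\<in>{A\<in>abelian_subgroups G. X \<subseteq> A}. mu2 G A (carrier G))"
    using finS notin by (simp add: mu2_def moebius.simps)
  finally show ?thesis
    by simp
qed

text \<open>Double counting of pairs of a commuting tuple and an abelian subgroup \<open>A\<close>
  containing its entries, weighted by \<open>mu2\<close>. Each tuple contributes -1; each
  \<open>A\<close> contributes its weight times \<open>card A ^ r\<close>, since tuples in
  \<open>A\<close> commute automatically.\<close>

lemma (in group) card_commuting_tuples: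
  assumes fin: "finite (carrier G)" and nonab: "\<not> comm_group G"
  shows "int (card (commuting_tuples G r))
       = - (\<Sum>A\<in>abelian_subgroups G. mu2 G A (carrier G) * int (card A) ^ r)"
proof -
  let ?T = "commuting_tuples G r" and ?Ab = "abelian_subgroups G"
  have finT: "finite ?T"
    unfolding commuting_tuples_def
    by (rule finite_subset[of _ "{..<r} \<rightarrow>\<^sub>E carrier G"]) (auto intro: finite_PiE fin)
  have finAb: "finite ?Ab"
    using fin by (rule finite_abelian_subgroups)
  have one: "(\<Sum>A\<in>{A\<in>?Ab. x ` {..<r} \<subseteq> A}. mu2 G A (carrier G)) = -1" if "x \<in> ?T" for x
    using that by (intro sum_mu2_abelian_overgroups fin nonab) (auto simp: commuting_tuples_def)
  have tuples: "{x\<in>?T. x ` {..<r} \<subseteq> A} = {..<r} \<rightarrow>\<^sub>E A" if "A \<in> ?Ab" for A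
  proof -
    have "A \<subseteq> carrier G"
      using that by (auto simp: abelian_subgroups_def dest: subgroup.subset)
    then show ?thesis
      using abelian_subgroups_commute[OF that]
      by (auto simp: commuting_tuples_def PiE_def Pi_def image_subset_iff)
  qed
  have "- int (card ?T) = (\<Sum>x\<in>?T. \<Sum>A\<in>{A\<in>?Ab. x ` {..<r} \<subseteq> A}. mu2 G A (carrier G))"
    by (simp add: one)
  also have "\<dots> = (\<Sum>A\<in>?Ab. \<Sum>x\<in>{x\<in>?T. x ` {..<r} \<subseteq> A}. mu2 G A (carrier G))"
    using finT finAb by (rule sum.swap_restrict)
  also have "\<dots> = (\<Sum>A\<in>?Ab. mu2 G A (carrier G) * int (card A) ^ r)"
    by (intro sum.cong refl) (simp add: tuples card_PiE)
  finally show ?thesis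
    by simp
qed

text \<open>After division by the group order, Lagrange's theorem turns each ratio of orders into an
  inverse index, and subgroups are collected by index. The formula holds for every \<open>r\<close>,
  including 0 and 1.\<close>

lemma (in group) commuting_prob_eq_spectral_sum:
  assumes fin: "finite (carrier G)" and nonab: "\<not> comm_group G"
  shows "commuting_prob G r
       = (\<Sum>m\<in>spectrum G. real_of_int (coeff_c G m) * inverse (real m) ^ r)"
proof -
  let ?Ab = "abelian_subgroups G" and ?mu = "\<lambda>A. mu2 G A (carrier G)"
  let ?ix = "\<lambda>A. card (rcosets A)"
  have finAb: "finite ?Ab"
    using fin by (rule finite_abelian_subgroups)
  have ord: "Coset.order G > 0"
    using fin by (simp add: order_gt_0_iff_finite)
  have lag: "?ix A * card A = Coset.order G" if "A \<in> ?Ab" for A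
    using that by (intro lagrange) (simp add: abelian_subgroups_def)
  have ratio: "real (card A) / real (Coset.order G) = inverse (real (?ix A))" if "A \<in> ?Ab" for A
  proof -
    have "card A \<noteq> 0"
      using lag[OF that] ord by (intro notI) simp
    then show ?thesis
      unfolding lag[OF that, symmetric] by (simp add: field_simps)
  qed
  \<comment> \<open>Abelian subgroups are proper, so the bound \<open>m \<ge> 2\<close> in
    \<open>spectrum\<close> discards no index that occurs.\<close>
  have ix_ge_2: "?ix A \<ge> 2" if "A \<in> ?Ab" for A
  proof (rule ccontr)
    assume "\<not> ?ix A \<ge> 2"
    then have "?ix A = 0 \<or> ?ix A = 1"
      by linarith
    then have "card A = card (carrier G)"
      using lag[OF that] ord by (auto simp: Coset.order_def)
    moreover have "A \<subseteq> carrier G"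
      using that by (auto simp: abelian_subgroups_def dest: subgroup.subset)
    ultimately have "A = carrier G"
      using fin by (simp add: card_subset_eq)
    then show False
      using that nonab carrier_notin_abelian_subgroups by blast
  qed
  have "commuting_prob G r = real_of_int (int (card (commuting_tuples G r))) / real (Coset.order G) ^ r"
    by (simp add: commuting_prob_def)
  also have "\<dots> = (\<Sum>A\<in>?Ab. - real_of_int (?mu A) * (real (card A) / real (Coset.order G)) ^ r)"
    unfolding card_commuting_tuples[OF assms]
    by (simp add: sum_negf sum_divide_distrib power_divide)
  also have "\<dots> = (\<Sum>A\<in>?Ab. - real_of_int (?mu A) * inverse (real (?ix A)) ^ r)"
    by (intro sum.cong refl) (simp only: ratio)
  also have "\<dots> = (\<Sum>m\<in>?ix ` ?Ab. \<Sum>A\<in>{A\<in>?Ab. ?ix A = m}.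
      - real_of_int (?mu A) * inverse (real (?ix A)) ^ r)"
    using finAb by (rule sum.image_gen)
  also have "\<dots> = (\<Sum>m\<in>?ix ` ?Ab. real_of_int (coeff_c G m) * inverse (real m) ^ r)"
    by (intro sum.cong refl) (simp add: coeff_c_def sum_negf sum_distrib_right)
  also have "\<dots> = (\<Sum>m\<in>spectrum G. real_of_int (coeff_c G m) * inverse (real m) ^ r)"
  proof (rule sum.mono_neutral_right)
    show "spectrum G \<subseteq> ?ix ` ?Ab"
    proof
      fix m
      assume "m \<in> spectrum G"
      then have "(\<Sum>A\<in>{A\<in>?Ab. ?ix A = m}. ?mu A) \<noteq> 0"
        by (simp add: spectrum_def coeff_c_def)
      then obtain A where "A \<in> {A\<in>?Ab. ?ix A = m}"
        by (rule sum.not_neutral_contains_not_neutral)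
      then show "m \<in> ?ix ` ?Ab"
        by blast
    qed
  qed (use finAb ix_ge_2 in \<open>auto simp: spectrum_def\<close>)
  finally show ?thesis .
qed

section \<open>The hierarchy of commuting probabilities\<close>

text \<open>The difference of the two hierarchies is an exponential sum over the union of the
  spectra. Its number of terms is at most the sum of the spectral sizes, so that many consecutive
  zeros force all coefficients to vanish.\<close>

lemma commuting_prob_determined:
  fixes G :: "('a, 'b) monoid_scheme" and H :: "('c, 'd) monoid_scheme"
  assumes G: "group G" "finite (carrier G)" "\<not> comm_group G"
    and H: "group H" "finite (carrier H)" "\<not> comm_group H"
    and agree: "\<And>r. 2 \<le> r \<Longrightarrow> r \<le> spectral_size G + spectral_size H + 1 \<Longrightarrow>
      commuting_prob H r = commuting_prob G r"
  shows "commuting_prob H r = commuting_prob G r"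
proof -
  let ?U = "spectrum G \<union> spectrum H"
  define v where "v m = inverse (real m)" for m
  define b where "b m = real_of_int (coeff_c H m) - real_of_int (coeff_c G m)" for m
  have finU: "finite ?U"
    using G H by (simp add: finite_spectrum)
  \<comment> \<open>Both sums run over the union: an element of it outside one spectrum is still at
    least 2, so its coefficient for that group is 0.\<close>
  have PG: "commuting_prob G r = (\<Sum>m\<in>?U. real_of_int (coeff_c G m) * v m ^ r)" for r
    unfolding group.commuting_prob_eq_spectral_sum[OF G] v_def
    using finU by (intro sum.mono_neutral_left) (auto simp: spectrum_def)
  have PH: "commuting_prob H r = (\<Sum>m\<in>?U. real_of_int (coeff_c H m) * v m ^ r)" for r
    unfolding group.commuting_prob_eq_spectral_sum[OF H] v_def
    using finU by (intro sum.mono_neutral_left) (auto simp: spectrum_def)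
  have diff: "commuting_prob H r - commuting_prob G r = (\<Sum>m\<in>?U. b m * v m ^ r)" for r
    unfolding PG PH by (simp add: b_def sum_subtractf algebra_simps)
  \<comment> \<open>The square moves the start of the agreement from r = 2 to exponent 0; it cancels
    later because \<open>m\<close> is positive.\<close>
  have "b m * v m ^ 2 = 0" if "m \<in> ?U" for m
  proof (rule exp_sum_coeffs_eq_0[where I = ?U and v = v and i = m
        and b = "\<lambda>m. b m * v m ^ 2" and N = "spectral_size G + spectral_size H"])
    show "card ?U \<le> spectral_size G + spectral_size H"
      by (simp add: spectral_size_def card_Un_le)
    fix n
    assume "n < spectral_size G + spectral_size H"
    then show "(\<Sum>m\<in>?U. b m * v m ^ 2 * v m ^ n) = 0"
      using agree[of "n + 2"] diff[of "n + 2"] by (simp add: power_add mult_ac power2_eq_square)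
  qed (use finU that in \<open>auto simp: v_def inj_on_def\<close>)
  then have "b m = 0" if "m \<in> ?U" for m
    using that by (force simp: v_def spectrum_def)
  then show ?thesis
    using diff[of r] by simp
qed

theorem corollary4p21:
  fixes G :: "('a, 'b) monoid_scheme"
    and m :: "nat \<Rightarrow> nat"
    and t :: nat
  assumes "group G" and "finite (carrier G)" and "\<not> comm_group G"
    and "spectrum G = m ` {1..t}" and "strict_mono_on {1..t} m"
  shows "(\<forall>r\<ge>2. commuting_prob G (r + t) =
            (\<Sum>j=1..t. (-1) ^ (j - 1) * elem_sym {1..t} (\<lambda>i. inverse (real (m i))) j
                        * commuting_prob G (r + t - j)))
    \<and> (\<forall>d<t. \<not> satisfies_linear_recurrence (\<lambda>n. commuting_prob G (n + 2)) d)
    \<and> has_rank (hankel G) t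
    \<and> (\<forall>H :: ('c, 'd) monoid_scheme.
          group H \<and> finite (carrier H) \<and> \<not> comm_group H \<and> spectral_size H = t
          \<and> (\<forall>r. 2 \<le> r \<and> r \<le> 2 * t + 1 \<longrightarrow> commuting_prob H r = commuting_prob G r)
          \<longrightarrow> (\<forall>r\<ge>2. commuting_prob H r = commuting_prob G r))"
proof -
  define v where "v i = inverse (real (m i))" for i
  \<comment> \<open>The square absorbs the offset of a sequence that starts at r = 2.\<close>
  define b where "b i = real_of_int (coeff_c G (m i)) * v i ^ 2" for i
  have inj_m: "inj_on m {1..t}"
    using assms(5) by (rule strict_mono_on_imp_inj_on)
  have spec: "m i \<ge> 2" "coeff_c G (m i) \<noteq> 0" if "i \<in> {1..t}" for i
    using that assms(4) by (auto simp: spectrum_def)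
  have inj_v: "inj_on v {1..t}"
    using inj_onD[OF inj_m] by (intro inj_onI) (simp add: v_def)
  have b_nz: "b i \<noteq> 0" if "i \<in> {1..t}" for i
    using spec[OF that] by (simp add: b_def v_def)
  have P: "commuting_prob G (n + 2) = (\<Sum>i\<in>{1..t}. b i * v i ^ n)" for n
    unfolding group.commuting_prob_eq_spectral_sum[OF assms(1-3)] assms(4) sum.reindex[OF inj_m]
    by (simp add: b_def v_def power_add power2_eq_square mult_ac)
  have size: "spectral_size G = t"
    using assms(4) card_image[OF inj_m] by (simp add: spectral_size_def)
  have "commuting_prob G (r + t) =
      (\<Sum>j=1..t. (-1) ^ (j - 1) * elem_sym {1..t} v j * commuting_prob G (r + t - j))"
    if "r \<ge> 2" for r
  proof -
    define n where "n = r - 2"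
    have n: "r = n + 2"
      using that by (simp add: n_def)
    have "commuting_prob G (n + t + 2) =
        (\<Sum>j=1..t. (-1) ^ (j - 1) * elem_sym {1..t} v j * commuting_prob G (n + t - j + 2))"
      using exp_sum_recurrence[of "{1..t}" b v n] unfolding P by simp
    also have "\<dots> =
        (\<Sum>j=1..t. (-1) ^ (j - 1) * elem_sym {1..t} v j * commuting_prob G (r + t - j))"
      \<comment> \<open>Since j is at most \<open>t\<close>, the truncated subtraction commutes with
        adding 2.\<close>
      by (intro sum.cong refl) (auto simp: n Suc_diff_le)
    finally show ?thesis
      by (simp add: n add_ac)
  qed
  moreover have "\<not> satisfies_linear_recurrence (\<lambda>n. commuting_prob G (n + 2)) d" if "d < t" for d
    unfolding P using exp_sum_no_shorter_recurrence[of "{1..t}" v b d] inj_v b_nz that by simp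
  moreover have "hankel G = (\<lambda>k l. \<Sum>i\<in>{1..t}. b i * v i ^ (k + l))"
    unfolding hankel_def P ..
  then have "has_rank (hankel G) t"
    using has_rank_hankel_exp_sum[of "{1..t}" v b] inj_v b_nz by simp
  moreover have "commuting_prob H r = commuting_prob G r"
    if "group H" "finite (carrier H)" "\<not> comm_group H" "spectral_size H = t"
      "\<forall>r. 2 \<le> r \<and> r \<le> 2 * t + 1 \<longrightarrow> commuting_prob H r = commuting_prob G r"
    for H :: "('c, 'd) monoid_scheme" and r
    \<comment> \<open>With both spectral sizes equal to \<open>t\<close>, the required range of
      agreement ends at \<open>2 * t + 1\<close>.\<close>
    using commuting_prob_determined[OF assms(1-3) that(1-3)] that(4,5) size by simp
  ultimately show ?thesis
    unfolding v_def by blast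
qed

end
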